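(* Let $\mathcal{C}$ be a finite acyclic category. Then $\operatorname{wwdim}(\mathcal{C})<\infty$ if and only if $\mathcal{C}$ is monic and left locally totally ordered.
   Context: A finite category has finitely many objects and morphisms. A small category $\mathcal{C}$ is acyclic if for all distinct objects $c\neq d$, $\mathrm{Hom}(c,d)\neq\varnothing$ implies $\mathrm{Hom}(d,c)=\varnothing$, and $\mathrm{Hom}(c,c)=\{\mathrm{id}_c\}$ for every object $c$. A functor is a weak embedding if it is faithful and injective on objects. An alphabet is a set $\Sigma$. A word of length $n$ over $\Sigma$ is a function $w\colon[n]\to\Sigma$, where $[n]=\{1,\dots,n\}$ and $[0]=\varnothing$. For words $w\colon[n]\to\Sigma$ and $w'\colon[m]\to\Sigma$, a subword inclusion $w'\to w$ is an injective order-preserving map $f\colon[m]\to[n]$ such that $w\circ f=w'$. $\mathrm{Word}(\Sigma)$ is the category of all words over $\Sigma$ with subword inclusions as morphisms. For a word $w$, $\mathrm{Sub}_w$ is the full subcategory of $\mathrm{Word}(\Sigma)$ spanned by all words that admit a morphism into $w$. The weak word dimension $\operatorname{wwdim}(\mathcal{C})$ is the least non-negative integer $n$ for which there exist an alphabet $\Sigma$, a word $w$ over $\Sigma$ of length $n$, and a weak embedding $\mathcal{C}\to\mathrm{Sub}_w$; it is $\infty$ if no such word exists. A category is monic if every morphism is a monomorphism ($f\circ g=f\circ h$ implies $g=h$). A small category is left locally totally ordered if each hom-set $\mathrm{Hom}(c,d)$ can be equipped with a total order such that, for all objects $c,d,e$, every $g\colon d\to e$ and all $f_1,f_2\in\mathrm{Hom}(c,d)$,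 $f_1<f_2$ implies $g\circ f_1<g\circ f_2$. *)

theory Defs
  imports Main "HOL-Library.FuncSet" "HOL-Library.Extended_Nat" "HOL-Library.Countable_Set"
begin

section \<open>Small categories\<close>

text \<open>
  A small category is given by a set of objects and a set of arrows. The value of
  \<open>Comp C g f\<close> (that is, \<open>g\<close> after \<open>f\<close>) matters only if \<open>Cod C f = Dom C g\<close>.
\<close>

record ('o, 'm) category =
  Obj :: "'o set"
  Arr :: "'m set"
  Dom :: "'m \<Rightarrow> 'o"
  Cod :: "'m \<Rightarrow> 'o"
  Ident :: "'o \<Rightarrow> 'm"
  Comp :: "'m \<Rightarrow> 'm \<Rightarrow> 'm"

definition Hom :: "('o, 'm) category \<Rightarrow> 'o \<Rightarrow> 'o \<Rightarrow> 'm set" where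
  "Hom C c d = {f \<in> Arr C. Dom C f = c \<and> Cod C f = d}"

locale category =
  fixes C :: "('o, 'm) category"
  assumes Dom_Obj: "f \<in> Arr C \<Longrightarrow> Dom C f \<in> Obj C"
    and Cod_Obj: "f \<in> Arr C \<Longrightarrow> Cod C f \<in> Obj C"
    and Ident_Hom: "c \<in> Obj C \<Longrightarrow> Ident C c \<in> Hom C c c"
    and Comp_Hom: "f \<in> Hom C c d \<Longrightarrow> g \<in> Hom C d e \<Longrightarrow> Comp C g f \<in> Hom C c e"
    and Comp_Ident_right: "f \<in> Hom C c d \<Longrightarrow> Comp C f (Ident C c) = f"
    and Comp_Ident_left: "f \<in> Hom C c d \<Longrightarrow> Comp C (Ident C d) f = f"
    and Comp_assoc: "f \<in> Hom C a b \<Longrightarrow> g \<in> Hom C b c \<Longrightarrow> h \<in> Hom C c d \<Longrightarrow>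
      Comp C h (Comp C g f) = Comp C (Comp C h g) f"

definition finite_category :: "('o, 'm) category \<Rightarrow> bool" where
  "finite_category C \<longleftrightarrow> finite (Obj C) \<and> finite (Arr C)"

definition acyclic_category :: "('o, 'm) category \<Rightarrow> bool" where
  "acyclic_category C \<longleftrightarrow>
    (\<forall>c\<in>Obj C. \<forall>d\<in>Obj C. c \<noteq> d \<longrightarrow> Hom C c d \<noteq> {} \<longrightarrow> Hom C d c = {}) \<and>
    (\<forall>c\<in>Obj C. Hom C c c = {Ident C c})"

definition monomorphism :: "('o, 'm) category \<Rightarrow> 'm \<Rightarrow> bool" where
  "monomorphism C f \<longleftrightarrow> f \<in> Arr C \<and>
    (\<forall>c\<in>Obj C. \<forall>g\<in>Hom C c (Dom C f). \<forall>h\<in>Hom C c (Dom C f).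
      Comp C f g = Comp C f h \<longrightarrow> g = h)"

definition monic_category :: "('o, 'm) category \<Rightarrow> bool" where
  "monic_category C \<longleftrightarrow> (\<forall>f\<in>Arr C. monomorphism C f)"

text \<open>Here \<open>r c d\<close> is the total order \<open>\<le>\<close> on \<open>Hom C c d\<close>, so its strict part \<open><\<close> is
  \<open>r c d - Id\<close>.\<close>

definition left_locally_totally_ordered :: "('o, 'm) category \<Rightarrow> bool" where
  "left_locally_totally_ordered C \<longleftrightarrow>
    (\<exists>r. (\<forall>c\<in>Obj C. \<forall>d\<in>Obj C. linear_order_on (Hom C c d) (r c d)) \<and>
      (\<forall>c\<in>Obj C. \<forall>d\<in>Obj C. \<forall>e\<in>Obj C. \<forall>g\<in>Hom C d e.
        \<forall>f1\<in>Hom C c d. \<forall>f2\<in>Hom C c d.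
          (f1, f2) \<in> r c d - Id \<longrightarrow> (Comp C g f1, Comp C g f2) \<in> r c e - Id))"

definition full_subcategory :: "('o, 'm) category \<Rightarrow> 'o set \<Rightarrow> ('o, 'm) category" where
  "full_subcategory C S =
    C\<lparr>Obj := Obj C \<inter> S, Arr := {f \<in> Arr C. Dom C f \<in> S \<and> Cod C f \<in> S}\<rparr>"

definition is_functor ::
  "('o, 'm) category \<Rightarrow> ('p, 'n) category \<Rightarrow> ('o \<Rightarrow> 'p) \<Rightarrow> ('m \<Rightarrow> 'n) \<Rightarrow> bool" where
  "is_functor C D Fo Fm \<longleftrightarrow>
    (\<forall>c\<in>Obj C. Fo c \<in> Obj D) \<and>
    (\<forall>c\<in>Obj C. \<forall>d\<in>Obj C. \<forall>f\<in>Hom C c d. Fm f \<in> Hom D (Fo c) (Fo d)) \<and>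
    (\<forall>c\<in>Obj C. Fm (Ident C c) = Ident D (Fo c)) \<and>
    (\<forall>c\<in>Obj C. \<forall>d\<in>Obj C. \<forall>e\<in>Obj C. \<forall>f\<in>Hom C c d. \<forall>g\<in>Hom C d e.
      Fm (Comp C g f) = Comp D (Fm g) (Fm f))"

definition faithful :: "('o, 'm) category \<Rightarrow> ('m \<Rightarrow> 'n) \<Rightarrow> bool" where
  "faithful C Fm \<longleftrightarrow> (\<forall>c\<in>Obj C. \<forall>d\<in>Obj C. inj_on Fm (Hom C c d))"

definition weak_embedding ::
  "('o, 'm) category \<Rightarrow> ('p, 'n) category \<Rightarrow> ('o \<Rightarrow> 'p) \<Rightarrow> ('m \<Rightarrow> 'n) \<Rightarrow> bool" where
  "weak_embedding C D Fo Fm \<longleftrightarrow> is_functor C D Fo Fm \<and> faithful C Fm \<and> inj_on Fo (Obj C)"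


section \<open>Words and subword inclusions\<close>

text \<open>
  A word over \<open>\<Sigma>\<close> is an element of \<open>lists \<Sigma>\<close>; the positions of a word \<open>w\<close> are
  \<open>{..<length w}\<close>, i.e. they are counted from 0. Maps between sets of positions are extensional
  functions, so that equality of maps is equality in HOL.
\<close>

definition subword_inclusions :: "'a list \<Rightarrow> 'a list \<Rightarrow> (nat \<Rightarrow> nat) set" where
  "subword_inclusions v w =
    {f \<in> {..<length v} \<rightarrow>\<^sub>E {..<length w}.
      inj_on f {..<length v} \<and> mono_on {..<length v} f \<and> (\<forall>i<length v. w ! f i = v ! i)}"

text \<open>An arrow \<open>v \<rightarrow> w\<close> of the category of words is a triple \<open>(v, f, w)\<close>.\<close>

type_synonym 'a word_arrow = "'a list \<times> (nat \<Rightarrow> nat) \<times> 'a list"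

definition Word :: "'a set \<Rightarrow> ('a list, 'a word_arrow) category" where
  "Word \<Sigma> = \<lparr>
     Obj = lists \<Sigma>,
     Arr = {(v, f, w). v \<in> lists \<Sigma> \<and> w \<in> lists \<Sigma> \<and> f \<in> subword_inclusions v w},
     Dom = (\<lambda>(v, f, w). v),
     Cod = (\<lambda>(v, f, w). w),
     Ident = (\<lambda>w. (w, restrict id {..<length w}, w)),
     Comp = (\<lambda>(v', g, w') (v, f, w). (v, compose {..<length v} g f, w'))\<rparr>"

definition Sub :: "'a set \<Rightarrow> 'a list \<Rightarrow> ('a list, 'a word_arrow) category" where
  "Sub \<Sigma> w = full_subcategory (Word \<Sigma>) {v. Hom (Word \<Sigma>) v w \<noteq> {}}"

definition embeds_in_word :: "('o, 'm) category \<Rightarrow> 'a set \<Rightarrow> 'a list \<Rightarrow> bool" where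
  "embeds_in_word C \<Sigma> w \<longleftrightarrow> w \<in> lists \<Sigma> \<and> (\<exists>Fo Fm. weak_embedding C (Sub \<Sigma> w) Fo Fm)"

text \<open>
  HOL cannot quantify over the type of letters, so alphabets are sets of natural numbers here.
  This is no restriction: by \<open>embeds_in_word_nat\<close> below, any alphabet of any type can be replaced
  by one consisting of natural numbers without changing the length of the word.
  The infimum is taken in \<^typ>\<open>enat\<close>: the least element of a nonempty set, and
  \<open>\<infinity>\<close> for the empty set.
\<close>

definition wwdim :: "('o, 'm) category \<Rightarrow> enat" where
  "wwdim C = Inf {enat n | n. \<exists>(\<Sigma> :: nat set) w. length w = n \<and> embeds_in_word C \<Sigma> w}"


section \<open>Sanity checks\<close>

lemma Hom_Word:
  "Hom (Word \<Sigma>) v w =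
    {(v, f, w) | f. v \<in> lists \<Sigma> \<and> w \<in> lists \<Sigma> \<and> f \<in> subword_inclusions v w}"
  by (auto simp: Hom_def Word_def)

lemma restrict_id_subword_inclusions:
  "restrict id {..<length w} \<in> subword_inclusions w w"
  by (auto simp: subword_inclusions_def inj_on_def mono_on_def)

lemma compose_subword_inclusions:
  assumes "f \<in> subword_inclusions u v" and "g \<in> subword_inclusions v w"
  shows "compose {..<length u} g f \<in> subword_inclusions u w"
proof -
  have f: "f i < length v" if "i < length u" for i
    using assms(1) that by (auto simp: subword_inclusions_def)
  have g: "g i < length w" if "i < length v" for i
    using assms(2) that by (auto simp: subword_inclusions_def)
  have "inj_on (compose {..<length u} g f) {..<length u}"
    using assms f by (auto simp: subword_inclusions_def inj_on_def compose_def)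
  moreover have "mono_on {..<length u} (compose {..<length u} g f)"
    using assms f by (auto simp: subword_inclusions_def mono_on_def compose_def)
  moreover have "w ! compose {..<length u} g f i = u ! i" if "i < length u" for i
    using assms f that by (auto simp: subword_inclusions_def compose_def)
  moreover have "compose {..<length u} g f \<in> {..<length u} \<rightarrow>\<^sub>E {..<length w}"
    using f g by (auto simp: compose_def)
  ultimately show ?thesis
    by (auto simp: subword_inclusions_def)
qed

lemma subword_inclusions_extensional:
  "f \<in> subword_inclusions v w \<Longrightarrow> f \<in> extensional {..<length v}"
  by (auto simp: subword_inclusions_def PiE_def)

lemma subword_inclusions_less:
  "f \<in> subword_inclusions v w \<Longrightarrow> i < length v \<Longrightarrow> f i < length w"
  by (auto simp: subword_inclusions_def)

lemma category_Word: "category (Word \<Sigma>)"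
proof
  fix f assume "f \<in> Arr (Word \<Sigma>)"
  then show "Dom (Word \<Sigma>) f \<in> Obj (Word \<Sigma>)" and "Cod (Word \<Sigma>) f \<in> Obj (Word \<Sigma>)"
    by (auto simp: Word_def)
next
  fix c assume "c \<in> Obj (Word \<Sigma>)"
  then show "Ident (Word \<Sigma>) c \<in> Hom (Word \<Sigma>) c c"
    using restrict_id_subword_inclusions[of c] by (simp add: Hom_Word) (simp add: Word_def)
next
  fix f c d g e assume "f \<in> Hom (Word \<Sigma>) c d" "g \<in> Hom (Word \<Sigma>) d e"
  then show "Comp (Word \<Sigma>) g f \<in> Hom (Word \<Sigma>) c e"
    unfolding Hom_Word by (auto simp: Word_def compose_subword_inclusions)
next
  fix f c d assume f: "f \<in> Hom (Word \<Sigma>) c d"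
  show "Comp (Word \<Sigma>) f (Ident (Word \<Sigma>) c) = f"
    using f unfolding Hom_Word
    by (auto simp: Word_def compose_def fun_eq_iff dest!: subword_inclusions_extensional
        intro: extensional_arb[symmetric])
  show "Comp (Word \<Sigma>) (Ident (Word \<Sigma>) d) f = f"
    using f unfolding Hom_Word
    by (auto simp: Word_def compose_def fun_eq_iff subword_inclusions_less
        intro: extensional_arb[OF subword_inclusions_extensional, symmetric])
next
  fix f a b g c h d
  assume "f \<in> Hom (Word \<Sigma>) a b" "g \<in> Hom (Word \<Sigma>) b c" "h \<in> Hom (Word \<Sigma>) c d"
  then show "Comp (Word \<Sigma>) h (Comp (Word \<Sigma>) g f) = Comp (Word \<Sigma>) (Comp (Word \<Sigma>) h g) f"
    unfolding Hom_Word
    by (auto simp: Word_def compose_def fun_eq_iff subword_inclusions_less)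
qed

lemma Hom_full_subcategory:
  "Hom (full_subcategory C S) c d = (if c \<in> S \<and> d \<in> S then Hom C c d else {})"
  by (auto simp: Hom_def full_subcategory_def)

lemma category_full_subcategory:
  assumes "category C"
  shows "category (full_subcategory C S)"
proof -
  interpret category C by fact
  have sel: "Obj (full_subcategory C S) = Obj C \<inter> S" "Ident (full_subcategory C S) = Ident C"
    "Comp (full_subcategory C S) = Comp C" "Dom (full_subcategory C S) = Dom C"
    "Cod (full_subcategory C S) = Cod C"
    "Arr (full_subcategory C S) = {f \<in> Arr C. Dom C f \<in> S \<and> Cod C f \<in> S}"
    by (simp_all add: full_subcategory_def)
  show ?thesis
    by unfold_locales
      (auto simp: sel Hom_full_subcategory Dom_Obj Cod_Obj Ident_Hom Comp_Hom Comp_Ident_left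
        Comp_Ident_right Comp_assoc split: if_splits)
qed

lemma category_Sub: "category (Sub \<Sigma> w)"
  by (simp add: Sub_def category_full_subcategory category_Word)

lemma Obj_Sub:
  "Obj (Sub \<Sigma> w) = {v \<in> lists \<Sigma>. w \<in> lists \<Sigma> \<and> subword_inclusions v w \<noteq> {}}"
  by (auto simp: Sub_def full_subcategory_def Hom_Word) (auto simp: Word_def)

lemma Hom_Sub:
  "Hom (Sub \<Sigma> w) u v = (if u \<in> Obj (Sub \<Sigma> w) \<and> v \<in> Obj (Sub \<Sigma> w)
    then {(u, f, v) | f. f \<in> subword_inclusions u v} else {})"
  unfolding Obj_Sub by (auto simp: Sub_def Hom_full_subcategory Hom_Word)

lemma Ident_Sub: "Ident (Sub \<Sigma> w) v = (v, restrict id {..<length v}, v)"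
  by (simp add: Sub_def full_subcategory_def Word_def)

lemma Comp_Sub: "Comp (Sub \<Sigma> w) (v', g, w') (u, f, v) = (u, compose {..<length u} g f, w')"
  by (simp add: Sub_def full_subcategory_def Word_def)

lemma weak_embedding_comp:
  assumes "weak_embedding C D Fo Fm" and "weak_embedding D E Go Gm"
  shows "weak_embedding C E (Go \<circ> Fo) (Gm \<circ> Fm)"
proof -
  have F: "is_functor C D Fo Fm" "faithful C Fm" "inj_on Fo (Obj C)"
    and G: "is_functor D E Go Gm" "faithful D Gm" "inj_on Go (Obj D)"
    using assms by (auto simp: weak_embedding_def)
  have FH: "Fm f \<in> Hom D (Fo c) (Fo d)" if "c \<in> Obj C" "d \<in> Obj C" "f \<in> Hom C c d" for c d f
    using F(1) that by (auto simp: is_functor_def)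
  have FO: "Fo c \<in> Obj D" if "c \<in> Obj C" for c
    using F(1) that by (auto simp: is_functor_def)
  have "is_functor C E (Go \<circ> Fo) (Gm \<circ> Fm)"
    unfolding is_functor_def
  proof (intro conjI ballI)
    fix c d e f g
    assume *: "c \<in> Obj C" "d \<in> Obj C" "e \<in> Obj C" "f \<in> Hom C c d" "g \<in> Hom C d e"
    have "Fm (Comp C g f) = Comp D (Fm g) (Fm f)"
      using F(1) * unfolding is_functor_def by blast
    moreover have "Gm (Comp D (Fm g) (Fm f)) = Comp E (Gm (Fm g)) (Gm (Fm f))"
      using G(1) FH[OF *(1,2,4)] FH[OF *(2,3,5)] FO *(1-3) unfolding is_functor_def by blast
    ultimately show "(Gm \<circ> Fm) (Comp C g f) = Comp E ((Gm \<circ> Fm) g) ((Gm \<circ> Fm) f)"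
      by simp
  next
    fix c d f assume *: "c \<in> Obj C" "d \<in> Obj C" "f \<in> Hom C c d"
    show "(Gm \<circ> Fm) f \<in> Hom E ((Go \<circ> Fo) c) ((Go \<circ> Fo) d)"
      using G(1) FH[OF *] FO *(1,2) unfolding is_functor_def by simp
  qed (use F(1) G(1) in \<open>auto simp: is_functor_def\<close>)
  moreover have "faithful C (Gm \<circ> Fm)"
    unfolding faithful_def
  proof (intro ballI comp_inj_on)
    fix c d assume *: "c \<in> Obj C" "d \<in> Obj C"
    show "inj_on Fm (Hom C c d)" using F(2) * by (auto simp: faithful_def)
    have "inj_on Gm (Hom D (Fo c) (Fo d))" using G(2) FO * by (auto simp: faithful_def)
    then show "inj_on Gm (Fm ` Hom C c d)" by (rule inj_on_subset) (use FH * in auto)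
  qed
  moreover have "inj_on (Go \<circ> Fo) (Obj C)"
    by (rule comp_inj_on[OF F(3)], rule inj_on_subset[OF G(3)]) (use FO in auto)
  ultimately show ?thesis by (simp add: weak_embedding_def)
qed

lemma set_subset_if_subword_inclusion:
  assumes "f \<in> subword_inclusions v w"
  shows "set v \<subseteq> set w"
proof
  fix x assume "x \<in> set v"
  then obtain i where "i < length v" "v ! i = x" by (auto simp: in_set_conv_nth)
  with assms have "f i < length w" "w ! f i = x" by (auto simp: subword_inclusions_def)
  then show "x \<in> set w" by auto
qed

lemma subword_inclusions_map:
  assumes "inj_on \<phi> A" and "set u \<subseteq> A" and "set v \<subseteq> A"
  shows "subword_inclusions (map \<phi> u) (map \<phi> v) = subword_inclusions u v"
proof -
  have "map \<phi> v ! f i = map \<phi> u ! i \<longleftrightarrow> v ! f i = u ! i"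
    if "f \<in> {..<length u} \<rightarrow>\<^sub>E {..<length v}" "i < length u" for f i
  proof -
    have l: "f i < length v" using that by auto
    then have "v ! f i \<in> A" "u ! i \<in> A" using assms that by auto
    then show ?thesis using assms(1) l that(2) by (auto simp: inj_on_eq_iff)
  qed
  then show ?thesis unfolding subword_inclusions_def by auto
qed

theorem embeds_in_word_nat:
  fixes \<Sigma> :: "'a set"
  assumes "embeds_in_word C \<Sigma> w"
  shows "\<exists>(\<Sigma>' :: nat set) w'. length w' = length w \<and> embeds_in_word C \<Sigma>' w'"
proof -
  obtain Fo Fm where w: "w \<in> lists \<Sigma>" and F: "weak_embedding C (Sub \<Sigma> w) Fo Fm"
    using assms by (auto simp: embeds_in_word_def)
  obtain \<phi> :: "'a \<Rightarrow> nat" where \<phi>: "inj_on \<phi> (set w)"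
    using countable_finite[of "set w"] by (auto simp: countable_def)
  define \<Sigma>' where "\<Sigma>' = \<phi> ` set w"
  define Go where "Go = map \<phi>"
  define Gm :: "'a word_arrow \<Rightarrow> nat word_arrow"
    where "Gm = (\<lambda>(u, f, v). (map \<phi> u, f, map \<phi> v))"
  have sub: "set v \<subseteq> set w" if "v \<in> Obj (Sub \<Sigma> w)" for v
    using that set_subset_if_subword_inclusion by (fastforce simp: Obj_Sub)
  have Obj: "map \<phi> v \<in> Obj (Sub \<Sigma>' (map \<phi> w))" if v: "v \<in> Obj (Sub \<Sigma> w)" for v
    using v sub[OF v] subword_inclusions_map[OF \<phi> sub[OF v] subset_refl]
    by (auto simp: Obj_Sub \<Sigma>'_def intro!: imageI)
  have "weak_embedding (Sub \<Sigma> w) (Sub \<Sigma>' (map \<phi> w)) Go Gm"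
    unfolding weak_embedding_def
  proof (intro conjI)
    show "inj_on Go (Obj (Sub \<Sigma> w))"
    proof (rule inj_onI)
      fix u v assume "u \<in> Obj (Sub \<Sigma> w)" "v \<in> Obj (Sub \<Sigma> w)" "Go u = Go v"
      then show "u = v"
        using map_inj_on[of \<phi> u v] inj_on_subset[OF \<phi>, of "set u \<union> set v"] sub
        by (auto simp: Go_def)
    qed
    show "faithful (Sub \<Sigma> w) Gm"
      by (auto simp: faithful_def inj_on_def Hom_Sub Gm_def)
    show "is_functor (Sub \<Sigma> w) (Sub \<Sigma>' (map \<phi> w)) Go Gm"
      unfolding is_functor_def
      using Obj subword_inclusions_map[OF \<phi> sub sub]
      by (auto simp: Hom_Sub Go_def Gm_def Ident_Sub Comp_Sub)
  qed
  then have "embeds_in_word C \<Sigma>' (map \<phi> w)"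
    using weak_embedding_comp[OF F] unfolding embeds_in_word_def \<Sigma>'_def
    by (metis image_set in_listsI)
  then show ?thesis by (intro exI[of _ \<Sigma>'] exI[of _ "map \<phi> w"]) simp
qed

end

theory Submission
  imports Defs "HOL-Library.Fun_Lexorder"
begin

text \<open>
  Word categories are monic, and ordering subword inclusions lexicographically makes them left
  locally totally ordered; both properties are reflected by faithful functors.

  Conversely, apply the Yoneda embedding: an object \<open>d\<close> is sent to the word over the alphabet
  \<open>Obj C\<close> whose positions are the arrows into \<open>d\<close>, each labelled by its domain. The arrows are
  ordered first by an arbitrary linear order of their domains and then by the given orders of the
  hom-sets. Composition with \<open>g\<close> from the left preserves labels and, by the order condition, is
  strictly increasing; in particular the order condition already forces \<open>g\<close> to be monic. Identities
  make this functor faithful, and acyclicity makes it injective on objects. All these words embed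
  into their concatenation.
\<close>

section \<open>Faithful functors reflect monicity and local orders\<close>

lemma functor_Obj: "is_functor C D Fo Fm \<Longrightarrow> c \<in> Obj C \<Longrightarrow> Fo c \<in> Obj D"
  by (simp add: is_functor_def)

lemma functor_Hom:
  "is_functor C D Fo Fm \<Longrightarrow> c \<in> Obj C \<Longrightarrow> d \<in> Obj C \<Longrightarrow> f \<in> Hom C c d \<Longrightarrow>
    Fm f \<in> Hom D (Fo c) (Fo d)"
  by (simp add: is_functor_def)

lemma functor_Comp:
  "is_functor C D Fo Fm \<Longrightarrow> c \<in> Obj C \<Longrightarrow> d \<in> Obj C \<Longrightarrow> e \<in> Obj C \<Longrightarrow>
    f \<in> Hom C c d \<Longrightarrow> g \<in> Hom C d e \<Longrightarrow> Fm (Comp C g f) = Comp D (Fm g) (Fm f)"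
  unfolding is_functor_def by blast

lemma faithful_eqD:
  "faithful C Fm \<Longrightarrow> c \<in> Obj C \<Longrightarrow> d \<in> Obj C \<Longrightarrow> f \<in> Hom C c d \<Longrightarrow> g \<in> Hom C c d \<Longrightarrow>
    Fm f = Fm g \<Longrightarrow> f = g"
  unfolding faithful_def by (blast dest: inj_onD)

text \<open>Functoriality carries an equation \<open>Comp C f g = Comp C f h\<close> to
  \<open>D\<close>, where \<open>Fm f\<close> cancels; faithfulness brings the result back to
  \<open>C\<close>.\<close>

lemma monic_category_reflect:
  assumes C: "category C" and F: "is_functor C D Fo Fm" "faithful C Fm"
    and D: "monic_category D"
  shows "monic_category C"
  unfolding monic_category_def monomorphism_def
proof (intro ballI conjI impI)
  interpret category C by (rule C)
  fix f c g h
  assume f: "f \<in> Arr C" and c: "c \<in> Obj C"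
    and g: "g \<in> Hom C c (Dom C f)" and h: "h \<in> Hom C c (Dom C f)"
    and eq: "Comp C f g = Comp C f h"
  have ob: "Dom C f \<in> Obj C" "Cod C f \<in> Obj C" using f by (simp_all add: Dom_Obj Cod_Obj)
  have fH: "f \<in> Hom C (Dom C f) (Cod C f)" using f by (simp add: Hom_def)
  have "Fm f \<in> Hom D (Fo (Dom C f)) (Fo (Cod C f))"
    by (rule functor_Hom[OF F(1) ob fH])
  then have Ff: "Fm f \<in> Arr D" "Dom D (Fm f) = Fo (Dom C f)" by (auto simp: Hom_def)
  have "Comp D (Fm f) (Fm g) = Comp D (Fm f) (Fm h)"
    using functor_Comp[OF F(1) c ob g fH] functor_Comp[OF F(1) c ob h fH] eq by simp
  then have "Fm g = Fm h"
    using D Ff functor_Obj[OF F(1) c] functor_Hom[OF F(1) c ob(1) g]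
      functor_Hom[OF F(1) c ob(1) h]
    unfolding monic_category_def monomorphism_def by metis
  then show "g = h" by (rule faithful_eqD[OF F(2) c ob(1) g h])
qed

text \<open>Injectivity gives antisymmetry and totality: distinct elements are compared through
  distinct images.\<close>

lemma linear_order_on_preimage:
  assumes r: "linear_order_on B r" and inj: "inj_on f A" and f: "f ` A \<subseteq> B"
  shows "linear_order_on A {(x, y). x \<in> A \<and> y \<in> A \<and> (f x, f y) \<in> r}"
proof -
  have r: "refl_on B r" "trans r" "antisym r" "total_on B r"
    using r by (simp_all add: order_on_defs)
  let ?s = "{(x, y). x \<in> A \<and> y \<in> A \<and> (f x, f y) \<in> r}"
  have "?s \<subseteq> A \<times> A" by blast
  moreover have "refl_on A ?s" using r(1) f by (auto simp: refl_on_def)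
  moreover have "trans ?s" using r(2) by (auto simp: trans_def)
  moreover have "antisym ?s" using r(3) inj by (auto simp: antisym_def inj_on_def)
  moreover have "total_on A ?s"
    using r(4) f inj by (simp add: total_on_def inj_on_eq_iff image_subset_iff)
  ultimately show ?thesis by (simp add: order_on_defs)
qed

text \<open>Each hom-set of \<open>C\<close> gets the order pulled back along \<open>Fm\<close>.
  Faithfulness makes it linear and keeps strict pairs strict in \<open>D\<close>.\<close>

lemma left_locally_totally_ordered_reflect:
  assumes C: "category C" and F: "is_functor C D Fo Fm" "faithful C Fm"
    and D: "left_locally_totally_ordered D"
  shows "left_locally_totally_ordered C"
proof -
  interpret category C by (rule C)
  obtain r where lin: "\<And>c d. c \<in> Obj D \<Longrightarrow> d \<in> Obj D \<Longrightarrow> linear_order_on (Hom D c d) (r c d)"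
    and mono: "\<And>c d e g f1 f2. c \<in> Obj D \<Longrightarrow> d \<in> Obj D \<Longrightarrow> e \<in> Obj D \<Longrightarrow> g \<in> Hom D d e \<Longrightarrow>
      f1 \<in> Hom D c d \<Longrightarrow> f2 \<in> Hom D c d \<Longrightarrow> (f1, f2) \<in> r c d - Id \<Longrightarrow>
      (Comp D g f1, Comp D g f2) \<in> r c e - Id"
    using D unfolding left_locally_totally_ordered_def by metis
  define s where "s c d = {(x, y). x \<in> Hom C c d \<and> y \<in> Hom C c d \<and>
    (Fm x, Fm y) \<in> r (Fo c) (Fo d)}" for c d
  have "linear_order_on (Hom C c d) (s c d)" if cd: "c \<in> Obj C" "d \<in> Obj C" for c d
    unfolding s_def
  proof (rule linear_order_on_preimage[OF lin])
    show "inj_on Fm (Hom C c d)" using F(2) cd by (simp add: faithful_def)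
    show "Fm ` Hom C c d \<subseteq> Hom D (Fo c) (Fo d)" using functor_Hom[OF F(1) cd] by blast
  qed (simp_all add: functor_Obj[OF F(1)] cd)
  moreover have "(Comp C g f1, Comp C g f2) \<in> s c e - Id"
    if ob: "c \<in> Obj C" "d \<in> Obj C" "e \<in> Obj C" and g: "g \<in> Hom C d e"
      and f: "f1 \<in> Hom C c d" "f2 \<in> Hom C c d" and lt: "(f1, f2) \<in> s c d - Id"
    for c d e g f1 f2
  proof -
    have "Fm f1 \<noteq> Fm f2" using faithful_eqD[OF F(2) ob(1,2) f] lt by auto
    then have "(Fm f1, Fm f2) \<in> r (Fo c) (Fo d) - Id" using lt by (simp add: s_def)
    then have "(Comp D (Fm g) (Fm f1), Comp D (Fm g) (Fm f2)) \<in> r (Fo c) (Fo e) - Id"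
      by (intro mono[of _ "Fo d"]) (use ob g f F(1) in \<open>auto simp: functor_Obj functor_Hom\<close>)
    then have "(Fm (Comp C g f1), Fm (Comp C g f2)) \<in> r (Fo c) (Fo e) - Id"
      by (simp add: functor_Comp[OF F(1) ob f(1) g] functor_Comp[OF F(1) ob f(2) g])
    then show ?thesis
      using Comp_Hom[OF f(1) g] Comp_Hom[OF f(2) g] by (auto simp: s_def)
  qed
  ultimately show ?thesis unfolding left_locally_totally_ordered_def by blast
qed

section \<open>Word categories\<close>

lemma Arr_SubE:
  assumes "f \<in> Arr (Sub \<Sigma> w)"
  obtains u h v where "f = (u, h, v)" "h \<in> subword_inclusions u v"
    "Dom (Sub \<Sigma> w) f = u" "Cod (Sub \<Sigma> w) f = v"
  using assms by (auto simp: Sub_def full_subcategory_def Word_def)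

lemma subword_inclusions_strict_mono:
  assumes "g \<in> subword_inclusions v w" "i < j" "j < length v"
  shows "g i < g j"
proof -
  have "g i \<le> g j" "g i \<noteq> g j"
    using assms by (auto simp: subword_inclusions_def mono_on_def inj_on_def)
  then show ?thesis by simp
qed

text \<open>An inclusion is injective on positions, so it cancels pointwise; extensionality settles
  the arguments that are not positions.\<close>

lemma monic_category_Sub: "monic_category (Sub \<Sigma> w)"
  unfolding monic_category_def monomorphism_def
proof (intro ballI conjI impI)
  fix f c g h
  assume f: "f \<in> Arr (Sub \<Sigma> w)"
    and g: "g \<in> Hom (Sub \<Sigma> w) c (Dom (Sub \<Sigma> w) f)" and h: "h \<in> Hom (Sub \<Sigma> w) c (Dom (Sub \<Sigma> w) f)"
    and eq: "Comp (Sub \<Sigma> w) f g = Comp (Sub \<Sigma> w) f h"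
  obtain u k v where k: "f = (u, k, v)" "k \<in> subword_inclusions u v" "Dom (Sub \<Sigma> w) f = u"
    using f by (rule Arr_SubE)
  obtain g' h' where g': "g = (c, g', u)" "g' \<in> subword_inclusions c u"
    and h': "h = (c, h', u)" "h' \<in> subword_inclusions c u"
    using g h k(3) by (auto simp: Hom_Sub split: if_splits)
  have "compose {..<length c} k g' = compose {..<length c} k h'"
    using eq by (simp add: k g' h' Comp_Sub)
  then have "k (g' i) = k (h' i)" if "i < length c" for i
    using that by (auto simp: compose_def fun_eq_iff restrict_def split: if_splits)
  moreover have "inj_on k {..<length u}" using k(2) by (simp add: subword_inclusions_def)
  ultimately have "g' i = h' i" if "i < length c" for i
    using that subword_inclusions_less[OF g'(2)] subword_inclusions_less[OF h'(2)]
    by (metis inj_onD lessThan_iff)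
  then have "g' = h'"
    using subword_inclusions_extensional[OF g'(2)] subword_inclusions_extensional[OF h'(2)]
    by (intro extensionalityI[of _ "{..<length c}"]) auto
  then show "g = h" by (simp add: g' h')
qed

text \<open>Inclusions are compared at the first position where they differ. Composing with a
  strictly increasing map keeps the agreement before that position and the strict inequality at
  it.\<close>

lemma left_locally_totally_ordered_Sub: "left_locally_totally_ordered (Sub \<Sigma> w)"
proof -
  let ?S = "Sub \<Sigma> w"
  define r :: "'a list \<Rightarrow> 'a list \<Rightarrow> ('a word_arrow \<times> 'a word_arrow) set"
    where "r u v = {(x, y). x \<in> Hom ?S u v \<and> y \<in> Hom ?S u v \<and>
      (x = y \<or> less_fun (fst (snd x)) (fst (snd y)))}" for u v
  have lin: "linear_order_on (Hom ?S u v) (r u v)" for u v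
    unfolding order_on_defs
  proof (intro conjI)
    show "r u v \<subseteq> Hom ?S u v \<times> Hom ?S u v" by (auto simp: r_def)
    show "refl_on (Hom ?S u v) (r u v)" by (auto simp: r_def refl_on_def)
    show "trans (r u v)" by (auto simp: r_def trans_def intro: less_fun_trans)
    show "antisym (r u v)" by (auto simp: r_def antisym_def dest: less_fun_asym)
    show "total_on (Hom ?S u v) (r u v)"
    proof (rule total_onI)
      fix x y assume xy: "x \<in> Hom ?S u v" "y \<in> Hom ?S u v" "x \<noteq> y"
      then obtain f g where f: "x = (u, f, v)" "f \<in> subword_inclusions u v"
        and g: "y = (u, g, v)" "g \<in> subword_inclusions u v"
        by (auto simp: Hom_Sub split: if_splits)
      \<comment> \<open>Off the positions of \<open>u\<close> both maps are
        \<open>undefined\<close>; this yields the finiteness that \<open>less_fun_trichotomy\<close>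
        asks for.\<close>
      have "{k. f k \<noteq> g k} \<subseteq> {..<length u}"
        using subword_inclusions_extensional[OF f(2)] subword_inclusions_extensional[OF g(2)]
        by (auto simp: extensional_def) (metis not_less)
      then have "finite {k. f k \<noteq> g k}" by (rule finite_subset) simp
      then have "less_fun f g \<or> f = g \<or> less_fun g f" by (rule less_fun_trichotomy)
      then show "(x, y) \<in> r u v \<or> (y, x) \<in> r u v" using xy by (auto simp: r_def f(1) g(1))
    qed
  qed
  have mono: "(Comp ?S g f1, Comp ?S g f2) \<in> r u y - Id"
    if f: "f1 \<in> Hom ?S u v" "f2 \<in> Hom ?S u v" and g: "g \<in> Hom ?S v y"
      and lt: "(f1, f2) \<in> r u v - Id" for u v y g f1 f2
  proof -
    interpret S: category ?S by (rule category_Sub)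
    obtain a b h where a: "f1 = (u, a, v)" "a \<in> subword_inclusions u v"
      and b: "f2 = (u, b, v)" "b \<in> subword_inclusions u v"
      and h: "g = (v, h, y)" "h \<in> subword_inclusions v y"
      using f g by (auto simp: Hom_Sub split: if_splits)
    have "less_fun a b" using lt by (auto simp: r_def a(1) b(1))
    then obtain k where k: "a k < b k" "\<And>i. i < k \<Longrightarrow> a i = b i" by (auto elim: less_funE)
    \<comment> \<open>The composites below are cut off at \<open>length u\<close>, so the first
      difference survives only if it is a position of \<open>u\<close>.\<close>
    have ku: "k < length u"
    proof (rule ccontr)
      assume "\<not> k < length u"
      then have "a k = undefined" "b k = undefined"
        using subword_inclusions_extensional[OF a(2)] subword_inclusions_extensional[OF b(2)]
        by (auto simp: extensional_def)
      then show False using k(1) by simp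
    qed
    have "less_fun (compose {..<length u} h a) (compose {..<length u} h b)"
    proof (rule less_funI, intro exI[of _ k] conjI allI impI)
      show "compose {..<length u} h a k < compose {..<length u} h b k"
        using subword_inclusions_strict_mono[OF h(2) k(1) subword_inclusions_less[OF b(2) ku]] ku
        by (simp add: compose_def)
    qed (use k(2) in \<open>simp add: compose_def\<close>)
    then show ?thesis
      using S.Comp_Hom[OF f(1) g] S.Comp_Hom[OF f(2) g]
      by (auto simp: r_def a(1) b(1) h(1) Comp_Sub less_fun_irrefl)
  qed
  show ?thesis
    unfolding left_locally_totally_ordered_def using lin mono by blast
qed

section \<open>Sorted enumerations\<close>

text \<open>Induction inserts \<open>a\<close> between the elements that precede it and the others.
  Totality puts \<open>a\<close> before the latter, and transitivity relates the two halves.\<close>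

lemma ex_sorted_wrt_list:
  assumes "finite A" "trans R" "total_on A R"
  shows "\<exists>xs. set xs = A \<and> sorted_wrt (\<lambda>x y. (x, y) \<in> R) xs"
  using assms(1,3)
proof (induction A rule: finite_induct)
  case empty
  then show ?case by (intro exI[of _ "[]"]) simp
next
  case (insert a A)
  then obtain xs where xs: "set xs = A" "sorted_wrt (\<lambda>x y. (x, y) \<in> R) xs"
    by (auto simp: total_on_def)
  let ?ys = "filter (\<lambda>x. (x, a) \<in> R) xs @ a # filter (\<lambda>x. (x, a) \<notin> R) xs"
  have "(a, x) \<in> R" if "x \<in> A" "(x, a) \<notin> R" for x
    using insert that by (auto simp: total_on_def)
  then have "sorted_wrt (\<lambda>x y. (x, y) \<in> R) ?ys"
    using xs transD[OF assms(2)] by (auto simp: sorted_wrt_append sorted_wrt_filter)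
  moreover have "set ?ys = insert a A" using xs by auto
  ultimately show ?case by blast
qed

text \<open>Meaningful only for members of \<open>xs\<close>; if there are repetitions, some
  occurrence is chosen.\<close>

definition position :: "'a list \<Rightarrow> 'a \<Rightarrow> nat" where
  "position xs x = inv_into {..<length xs} ((!) xs) x"

lemma position_less: "x \<in> set xs \<Longrightarrow> position xs x < length xs"
  unfolding position_def using inv_into_into[of x "(!) xs" "{..<length xs}"]
  by (auto simp: set_conv_nth image_def)

lemma nth_position: "x \<in> set xs \<Longrightarrow> xs ! position xs x = x"
  unfolding position_def by (rule f_inv_into_f) (auto simp: set_conv_nth image_def)

text \<open>Restricted to the positions of \<open>xs\<close> because
  \<open>subword_inclusions\<close> contains only extensional maps.\<close>

definition position_map :: "('a \<Rightarrow> 'b) \<Rightarrow> 'a list \<Rightarrow> 'b list \<Rightarrow> nat \<Rightarrow> nat" where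
  "position_map h xs ys = (\<lambda>i\<in>{..<length xs}. position ys (h (xs ! i)))"

lemma position_map_nth:
  "i < length xs \<Longrightarrow> h ` set xs \<subseteq> set ys \<Longrightarrow>
    position_map h xs ys i < length ys \<and> ys ! position_map h xs ys i = h (xs ! i)"
  by (simp add: position_map_def position_less nth_position image_subset_iff)

text \<open>Labels are preserved by \<open>label\<close>, and strict growth comes from asymmetry of
  \<open>S\<close>: equal positions would give a reflexive pair in \<open>S\<close>, reversed
  positions a pair in both directions.\<close>

lemma position_map_subword_inclusion:
  assumes xs: "sorted_wrt (\<lambda>x y. (x, y) \<in> R) xs" and ys: "sorted_wrt (\<lambda>x y. (x, y) \<in> S) ys"
    and S: "asym S" and h: "h ` set xs \<subseteq> set ys"
    and mono: "\<And>x y. x \<in> set xs \<Longrightarrow> y \<in> set xs \<Longrightarrow> (x, y) \<in> R \<Longrightarrow> (h x, h y) \<in> S"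
    and label: "\<And>x. x \<in> set xs \<Longrightarrow> q (h x) = p x"
  shows "position_map h xs ys \<in> subword_inclusions (map p xs) (map q ys)"
proof -
  let ?f = "position_map h xs ys"
  note f = position_map_nth[OF _ h]
  have less: "?f i < ?f j" if ij: "i < j" "j < length xs" for i j
  proof (rule ccontr)
    assume "\<not> ?f i < ?f j"
    then consider "?f i = ?f j" | "?f j < ?f i" by linarith
    moreover have "(xs ! i, xs ! j) \<in> R" using sorted_wrt_nth_less[OF xs ij] .
    then have "(ys ! ?f i, ys ! ?f j) \<in> S" using ij f mono by simp
    moreover have "(ys ! ?f j, ys ! ?f i) \<in> S" if "?f j < ?f i"
      using sorted_wrt_nth_less[OF ys that] f ij by simp
    ultimately show False using S by (metis asymD)
  qed
  have "inj_on ?f {..<length xs}"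
    by (rule linorder_inj_onI) (use less in \<open>force\<close>)+
  moreover have "mono_on {..<length xs} ?f"
    by (rule mono_onI) (metis less lessThan_iff le_less order_refl)
  moreover have "?f \<in> {..<length xs} \<rightarrow>\<^sub>E {..<length ys}"
    using f by (auto simp: position_map_def)
  ultimately show ?thesis
    using f label by (auto simp: subword_inclusions_def)
qed

lemma subword_inclusion_append:
  "(\<lambda>i\<in>{..<length v}. length u + i) \<in> subword_inclusions v (u @ v @ w)"
  by (auto simp: subword_inclusions_def inj_on_def mono_on_def nth_append)

section \<open>The word of arrows into an object\<close>

theorem ordered_acyclic_embeds_in_word:
  fixes C :: "('o, 'm) category"
  assumes "category C" and fin: "finite_category C" and acyc: "acyclic_category C"
    and ord: "left_locally_totally_ordered C"
  shows "\<exists>w. embeds_in_word C (Obj C) w"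
proof -
  interpret category C by fact
  obtain r where lin: "\<And>c d. c \<in> Obj C \<Longrightarrow> d \<in> Obj C \<Longrightarrow> linear_order_on (Hom C c d) (r c d)"
    and r_mono: "\<And>c d e g f1 f2. c \<in> Obj C \<Longrightarrow> d \<in> Obj C \<Longrightarrow> e \<in> Obj C \<Longrightarrow> g \<in> Hom C d e \<Longrightarrow>
      f1 \<in> Hom C c d \<Longrightarrow> f2 \<in> Hom C c d \<Longrightarrow> (f1, f2) \<in> r c d - Id \<Longrightarrow>
      (Comp C g f1, Comp C g f2) \<in> r c e - Id"
    using ord unfolding left_locally_totally_ordered_def by metis

  \<comment> \<open>Ordering the arrows into an object\<close>
  obtain \<kappa> :: "'o \<Rightarrow> nat" where \<kappa>: "inj_on \<kappa> (Obj C)"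
    using fin finite_imp_inj_to_nat_seg unfolding finite_category_def by metis
  define I where "I d = {f \<in> Arr C. Cod C f = d}" for d
  \<comment> \<open>A strict lexicographic order: first the numbering \<open>\<kappa>\<close> of the
    domains, then the given order within a hom-set. Left composition keeps domains, so the first key
    never changes.\<close>
  define R where "R d = {(f, g). f \<in> I d \<and> g \<in> I d \<and> (\<kappa> (Dom C f) < \<kappa> (Dom C g) \<or>
    Dom C f = Dom C g \<and> (f, g) \<in> r (Dom C f) d - Id)}" for d
  have I_Hom: "f \<in> I d \<longleftrightarrow> f \<in> Hom C (Dom C f) d" for f d by (auto simp: I_def Hom_def)
  have I_Obj: "Dom C f \<in> Obj C" "d \<in> Obj C" if "f \<in> I d" for f d
    using that Dom_Obj Cod_Obj by (auto simp: I_def)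
  have transR: "trans (R d)" for d
  proof (rule transI)
    fix x y z assume xyz: "(x, y) \<in> R d" "(y, z) \<in> R d"
    then have "x \<in> I d" by (simp add: R_def)
    then have "linear_order_on (Hom C (Dom C x) d) (r (Dom C x) d)" by (simp add: lin I_Obj)
    then have "trans (r (Dom C x) d - Id)"
      by (intro trans_diff_Id) (simp_all add: order_on_defs)
    note t = transD[OF this, of x y z]
    \<comment> \<open>Either one of the two comparisons raises \<open>\<kappa>\<close>, or all three
      arrows lie in one hom-set.\<close>
    consider "\<kappa> (Dom C x) < \<kappa> (Dom C z)"
      | "Dom C x = Dom C y" "Dom C y = Dom C z"
        "(x, y) \<in> r (Dom C x) d - Id" "(y, z) \<in> r (Dom C y) d - Id"
      using xyz unfolding R_def by force
    then show "(x, z) \<in> R d"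
    proof cases
      case 1
      then show ?thesis using xyz by (simp add: R_def)
    next
      case 2
      then have "(x, z) \<in> r (Dom C x) d - Id" using t by simp
      then show ?thesis using 2 xyz by (simp add: R_def)
    qed
  qed
  have irreflR: "(x, x) \<notin> R d" for x d by (simp add: R_def)
  have asymR: "asym (R d)" for d
    by (rule asymI) (use transR irreflR in \<open>blast dest: transD\<close>)
  have totalR: "total_on (I d) (R d)" for d
  proof (rule total_onI)
    fix x y assume xy: "x \<in> I d" "y \<in> I d" "x \<noteq> y"
    show "(x, y) \<in> R d \<or> (y, x) \<in> R d"
    proof (cases "Dom C x = Dom C y")
      case True
      have "total_on (Hom C (Dom C x) d) (r (Dom C x) d)"
        using lin[OF I_Obj] xy(1) by (simp add: order_on_defs)
      moreover have "x \<in> Hom C (Dom C x) d" "y \<in> Hom C (Dom C x) d"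
        using xy True by (simp_all add: I_Hom)
      ultimately show ?thesis using xy True by (auto simp: R_def total_on_def)
    next
      case False
      then have "\<kappa> (Dom C x) \<noteq> \<kappa> (Dom C y)" using \<kappa> xy I_Obj by (meson inj_onD)
      then show ?thesis using xy by (auto simp: R_def)
    qed
  qed
  have "finite (I d)" for d using fin by (simp add: finite_category_def I_def)
  then have "\<exists>L. set L = I d \<and> sorted_wrt (\<lambda>x y. (x, y) \<in> R d) L" for d
    by (intro ex_sorted_wrt_list transR totalR)
  then obtain L where L: "\<And>d. set (L d) = I d"
    and sortedL: "\<And>d. sorted_wrt (\<lambda>x y. (x, y) \<in> R d) (L d)"
    by metis
  have L_less: "i < length (L d) \<Longrightarrow> L d ! i \<in> I d" for i d using L nth_mem by blast
  \<comment> \<open>Sorting by a strict order excludes repetitions, so an arrow determines its index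
    in \<open>L d\<close>.\<close>
  have distinctL: "distinct (L d)" for d
    unfolding distinct_conv_nth
  proof (intro allI impI)
    fix i j assume "i < length (L d)" "j < length (L d)" "i \<noteq> j"
    then have "(L d ! i, L d ! j) \<in> R d \<or> (L d ! j, L d ! i) \<in> R d"
      using sorted_wrt_nth_less[OF sortedL] by (metis linorder_neqE_nat)
    then show "L d ! i \<noteq> L d ! j" using asymR by (metis asymD)
  qed

  \<comment> \<open>The functor into words\<close>
  define W where "W d = map (Dom C) (L d)" for d
  \<comment> \<open>Left composition with \<open>g\<close>, read on positions in the sorted lists
    instead of on arrows.\<close>
  define P where "P g = position_map (Comp C g) (L (Dom C g)) (L (Cod C g))" for g
  define F where "F g = (W (Dom C g), P g, W (Cod C g))" for g
  have F_Hom: "F g = (W d, P g, W e)" if "g \<in> Hom C d e" for g d e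
    using that by (auto simp: F_def Hom_def)
  have lenW: "length (W d) = length (L d)" for d by (simp add: W_def)
  have setW: "set (W d) = {c. Hom C c d \<noteq> {}}" for d
    by (auto simp: W_def L I_def Hom_def)
  have Comp_I: "Comp C g f \<in> I e \<and> Dom C (Comp C g f) = Dom C f"
    if "g \<in> Hom C d e" "f \<in> I d" for g f d e
    using Comp_Hom[of f "Dom C f" d g e] that by (auto simp: I_def Hom_def)
  have P_incl: "P g \<in> subword_inclusions (W d) (W e)" if g: "g \<in> Hom C d e" for g d e
  proof -
    have de: "Dom C g = d" "Cod C g = e" "d \<in> Obj C" "e \<in> Obj C"
      using g Dom_Obj Cod_Obj by (auto simp: Hom_def)
    have "(Comp C g x, Comp C g y) \<in> R e" if xy: "(x, y) \<in> R d" for x y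
    proof -
      have I: "x \<in> I d" "y \<in> I d" using xy by (auto simp: R_def)
      \<comment> \<open>Only arrows with a common domain need the order condition; otherwise the
        comparison by \<open>\<kappa>\<close> is untouched.\<close>
      have "(Comp C g x, Comp C g y) \<in> r (Dom C x) e - Id"
        if "Dom C x = Dom C y" "(x, y) \<in> r (Dom C x) d - Id"
        using r_mono[of "Dom C x" d e g x y] I g that de I_Obj I_Hom by metis
      then show ?thesis
        using xy Comp_I[OF g I(1)] Comp_I[OF g I(2)] unfolding R_def by auto
    qed
    then show ?thesis
      unfolding P_def W_def de
      by (intro position_map_subword_inclusion[OF sortedL sortedL asymR])
        (use Comp_I[OF g] in \<open>auto simp: L\<close>)
  qed
  have P_nth: "P g i < length (L e)" "L e ! P g i = Comp C g (L d ! i)"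
    if g: "g \<in> Hom C d e" and i: "i < length (L d)" for g d e i
  proof -
    have "Comp C g ` set (L d) \<subseteq> set (L e)" using Comp_I[OF g] by (auto simp: L)
    moreover have "Dom C g = d" "Cod C g = e" using g by (auto simp: Hom_def)
    ultimately show "P g i < length (L e)" "L e ! P g i = Comp C g (L d ! i)"
      using position_map_nth[OF i] by (auto simp: P_def)
  qed
  have P_ext: "P g \<in> extensional {..<length (L d)}" if "g \<in> Hom C d e" for g d e
    using subword_inclusions_extensional[OF P_incl[OF that]] by (simp add: lenW)
  \<comment> \<open>The entries of \<open>L e\<close> are distinct, so a position map is known from
    the arrows it points to. This reduces both functor laws to equations between arrows.\<close>
  have P_eqI: "P g = h"
    if "g \<in> Hom C d e" "h \<in> extensional {..<length (L d)}"
      "\<And>i. i < length (L d) \<Longrightarrow> h i < length (L e) \<and> L e ! h i = Comp C g (L d ! i)" for g h d e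
    using P_ext[OF that(1)] that(2)
  proof (rule extensionalityI)
    fix i assume "i \<in> {..<length (L d)}"
    then have i: "i < length (L d)" by simp
    have "L e ! P g i = L e ! h i" using P_nth(2)[OF that(1) i] that(3)[OF i] by simp
    then show "P g i = h i"
      using nth_eq_iff_index_eq[OF distinctL P_nth(1)[OF that(1) i]] that(3)[OF i] by blast
  qed

  \<comment> \<open>The ambient word\<close>
  obtain os where os: "set os = Obj C"
    using fin finite_list unfolding finite_category_def by blast
  define w where "w = concat (map W os)"
  have W_lists: "W d \<in> lists (Obj C)" for d
    by (auto simp: W_def L I_def Dom_Obj)
  have w_lists: "w \<in> lists (Obj C)" using W_lists by (fastforce simp: w_def)
  have W_Obj: "W d \<in> Obj (Sub (Obj C) w)" if d: "d \<in> Obj C" for d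
  proof -
    \<comment> \<open>Cutting \<open>os\<close> at an occurrence of \<open>d\<close> exhibits
      \<open>W d\<close> as a block of consecutive letters of \<open>w\<close>.\<close>
    obtain os1 os2 where "os = os1 @ d # os2" using d os split_list by metis
    then have "w = concat (map W os1) @ W d @ concat (map W os2)" by (simp add: w_def)
    then have "subword_inclusions (W d) w \<noteq> {}" using subword_inclusion_append by blast
    then show ?thesis using W_lists w_lists by (simp add: Obj_Sub)
  qed

  \<comment> \<open>The weak embedding\<close>
  have "weak_embedding C (Sub (Obj C) w) W F"
    unfolding weak_embedding_def is_functor_def faithful_def
  proof (intro conjI ballI)
    fix c assume c: "c \<in> Obj C"
    show "W c \<in> Obj (Sub (Obj C) w)" using c by (rule W_Obj)
    have id: "Ident C c \<in> Hom C c c" using c by (rule Ident_Hom)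
    have "P (Ident C c) = restrict id {..<length (L c)}"
    proof (rule P_eqI[OF id])
      fix i assume i: "i < length (L c)"
      show "restrict id {..<length (L c)} i < length (L c) \<and>
        L c ! restrict id {..<length (L c)} i = Comp C (Ident C c) (L c ! i)"
        using i L_less[OF i] Comp_Ident_left[of "L c ! i" "Dom C (L c ! i)" c] by (simp add: I_Hom)
    qed simp
    then show "F (Ident C c) = Ident (Sub (Obj C) w) (W c)"
      by (simp add: F_Hom[OF id] Ident_Sub lenW)
  next
    fix c d f assume *: "c \<in> Obj C" "d \<in> Obj C" "f \<in> Hom C c d"
    then show "F f \<in> Hom (Sub (Obj C) w) (W c) (W d)"
      using P_incl[OF *(3)] W_Obj by (auto simp: F_Hom[OF *(3)] Hom_Sub)
  next
    fix c d e f g assume "f \<in> Hom C c d" and g: "g \<in> Hom C d e"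
    note f = this(1)
    have gf: "Comp C g f \<in> Hom C c e" using f g by (rule Comp_Hom)
    have "P (Comp C g f) = compose {..<length (L c)} (P g) (P f)"
    proof (rule P_eqI[OF gf])
      fix i assume i: "i < length (L c)"
      have "L c ! i \<in> Hom C (Dom C (L c ! i)) c" using L_less[OF i] by (simp add: I_Hom)
      then show "compose {..<length (L c)} (P g) (P f) i < length (L e) \<and>
        L e ! compose {..<length (L c)} (P g) (P f) i = Comp C (Comp C g f) (L c ! i)"
        using i P_nth[OF f i] P_nth[OF g P_nth(1)[OF f i]] Comp_assoc[OF _ f g]
        by (simp add: compose_def)
    qed simp
    then show "F (Comp C g f) = Comp (Sub (Obj C) w) (F g) (F f)"
      by (simp add: F_Hom[OF f] F_Hom[OF g] F_Hom[OF gf] Comp_Sub lenW)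
  next
    fix c d assume c: "c \<in> Obj C"
    show "inj_on F (Hom C c d)"
    proof (rule inj_onI)
      fix f g assume f: "f \<in> Hom C c d" and g: "g \<in> Hom C c d" and "F f = F g"
      then have P: "P f = P g" by (simp add: F_def)
      \<comment> \<open>As in the Yoneda lemma, evaluating \<open>P f\<close> at the position of the
        identity of \<open>c\<close> recovers \<open>f\<close>.\<close>
      have "Ident C c \<in> set (L c)" using Ident_Hom[OF c] by (auto simp: L I_def Hom_def)
      then obtain i where i: "i < length (L c)" "L c ! i = Ident C c"
        by (auto simp: in_set_conv_nth)
      have "Comp C f (Ident C c) = Comp C g (Ident C c)"
        using P_nth(2)[OF f i(1)] P_nth(2)[OF g i(1)] by (simp add: P i(2))
      then show "f = g" using f g by (simp add: Comp_Ident_right)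
    qed
  next
    show "inj_on W (Obj C)"
    proof (rule inj_onI)
      fix c d assume cd: "c \<in> Obj C" "d \<in> Obj C" and eq: "W c = W d"
      \<comment> \<open>Identities make each object a letter of its own word. Equal words therefore
        yield arrows in both directions, and acyclicity leaves only \<open>c = d\<close>.\<close>
      have "c \<in> set (W c)" "d \<in> set (W d)" using cd Ident_Hom by (auto simp: setW)
      then have "c \<in> set (W d)" "d \<in> set (W c)" by (simp_all add: eq)
      then have "Hom C c d \<noteq> {}" "Hom C d c \<noteq> {}" by (simp_all add: setW)
      then show "c = d" using acyc cd unfolding acyclic_category_def by metis
    qed
  qed
  then show ?thesis using w_lists unfolding embeds_in_word_def by blast
qed

text \<open>Lengths are finite, so the infimum is infinite exactly when it ranges over the empty
  set.\<close>

lemma wwdim_less_infinity_iff: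
  "wwdim C < \<infinity> \<longleftrightarrow> (\<exists>(\<Sigma> :: nat set) w. embeds_in_word C \<Sigma> w)"
  unfolding wwdim_def Inf_less_iff by auto

theorem corollary5p11:
  fixes C :: "('o, 'm) category"
  assumes "category C" and "finite_category C" and "acyclic_category C"
  shows "wwdim C < \<infinity> \<longleftrightarrow> monic_category C \<and> left_locally_totally_ordered C"
proof
  assume "wwdim C < \<infinity>"
  then obtain \<Sigma> :: "nat set" and w Fo Fm where "weak_embedding C (Sub \<Sigma> w) Fo Fm"
    unfolding wwdim_less_infinity_iff embeds_in_word_def by blast
  then have "is_functor C (Sub \<Sigma> w) Fo Fm" "faithful C Fm" by (simp_all add: weak_embedding_def)
  note F = assms(1) this
  show "monic_category C \<and> left_locally_totally_ordered C"
    using monic_category_reflect[OF F monic_category_Sub]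
      left_locally_totally_ordered_reflect[OF F left_locally_totally_ordered_Sub] by blast
next
  assume "monic_category C \<and> left_locally_totally_ordered C"
  then obtain w where "embeds_in_word C (Obj C) w"
    using ordered_acyclic_embeds_in_word[OF assms] by blast
  \<comment> \<open>The letters found so far are objects of \<open>C\<close>; recoding them as
    natural numbers matches the alphabets over which \<open>wwdim\<close> ranges.\<close>
  from embeds_in_word_nat[OF this] show "wwdim C < \<infinity>"
    unfolding wwdim_less_infinity_iff by blast
qed

end
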